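(* Let $C$ be a caterpillar and let $G$ be any graph. Then $\mu_{\mathrm{int}}(G\odot C)\le \max\{2,\mu_{\mathrm{int}}(G)\}$.
   Context: Graphs are finite and simple. A caterpillar is a tree for which the removal of all leaves produces a path. For graphs $G$ and $H$ with $V(G)=\{v_1,\dots,v_n\}$, the corona product $G\odot H$ is the graph obtained by taking $G$ and $n$ disjoint copies $H_1,\dots,H_n$ of $H$ and, for each $i\in\{1,\dots,n\}$, adding the edge $v_ix$ for every $x\in V(H_i)$. An improper interval coloring of a graph $G$ is an assignment of colors (natural numbers) to the edges of $G$, not necessarily proper, such that for every vertex $v$ the set of colors on the edges incident with $v$ is an integral interval (a set of consecutive integers). It is $k$-improper if at most $k$ edges with the same color all share a common endpoint, i.e. at each vertex each color appears on at most $k$ incident edges. The interval coloring impropriety $\mu_{\mathrm{int}}(G)$ is the smallest positive integer $k$ such that $G$ has a $k$-improper interval coloring. *)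

theory Defs
  imports Main
begin

section \<open>Finite simple graphs\<close>

text \<open>The edges of an undirected graph are two-element sets of vertices.\<close>

record 'a ugraph =
  verts :: "'a set"
  edges :: "'a set set"

definition simple_graph :: "'a ugraph \<Rightarrow> bool" where
  "simple_graph G \<longleftrightarrow> finite (verts G) \<and> (\<forall>e\<in>edges G. e \<subseteq> verts G \<and> card e = 2)"

definition adjacent :: "'a ugraph \<Rightarrow> 'a \<Rightarrow> 'a \<Rightarrow> bool" where
  "adjacent G u v \<longleftrightarrow> {u, v} \<in> edges G"

definition incident_edges :: "'a ugraph \<Rightarrow> 'a \<Rightarrow> 'a set set" where
  "incident_edges G v = {e \<in> edges G. v \<in> e}"

definition degree :: "'a ugraph \<Rightarrow> 'a \<Rightarrow> nat" where
  "degree G v = card (incident_edges G v)"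

definition induced_subgraph :: "'a ugraph \<Rightarrow> 'a set \<Rightarrow> 'a ugraph" where
  "induced_subgraph G S = \<lparr>verts = verts G \<inter> S, edges = {e \<in> edges G. e \<subseteq> S}\<rparr>"

section \<open>Trees and caterpillars\<close>

definition is_walk :: "'a ugraph \<Rightarrow> 'a list \<Rightarrow> bool" where
  "is_walk G p \<longleftrightarrow> p \<noteq> [] \<and> set p \<subseteq> verts G \<and> successively (adjacent G) p"

definition connected_graph :: "'a ugraph \<Rightarrow> bool" where
  "connected_graph G \<longleftrightarrow> verts G \<noteq> {} \<and>
     (\<forall>u\<in>verts G. \<forall>v\<in>verts G. \<exists>p. is_walk G p \<and> hd p = u \<and> last p = v)"

definition is_cycle :: "'a ugraph \<Rightarrow> 'a list \<Rightarrow> bool" where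
  "is_cycle G p \<longleftrightarrow> is_walk G p \<and> distinct p \<and> 3 \<le> length p \<and> adjacent G (last p) (hd p)"

definition is_tree :: "'a ugraph \<Rightarrow> bool" where
  "is_tree T \<longleftrightarrow> simple_graph T \<and> connected_graph T \<and> (\<nexists>p. is_cycle T p)"

definition leaves :: "'a ugraph \<Rightarrow> 'a set" where
  "leaves G = {v \<in> verts G. degree G v = 1}"

text \<open>The graph without vertices counts as a path (the list may be empty). This matters only
  for the tree with two vertices, whose vertices are both leaves: it is a caterpillar.\<close>

definition path_graph :: "'a ugraph \<Rightarrow> bool" where
  "path_graph P \<longleftrightarrow> (\<exists>vs. distinct vs \<and> verts P = set vs \<and>
     edges P = {{vs ! i, vs ! Suc i} | i. Suc i < length vs})"

definition caterpillar :: "'a ugraph \<Rightarrow> bool" where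
  "caterpillar C \<longleftrightarrow> is_tree C \<and> path_graph (induced_subgraph C (verts C - leaves C))"

section \<open>Corona product\<close>

text \<open>The vertex \<open>v\<close> of \<open>G\<close> becomes \<open>Inl v\<close>; the vertex \<open>x\<close> of the copy of \<open>H\<close>
  attached to \<open>v\<close> becomes \<open>Inr (v, x)\<close>.\<close>

definition corona :: "'a ugraph \<Rightarrow> 'b ugraph \<Rightarrow> ('a + 'a \<times> 'b) ugraph" (infixl "\<odot>" 70) where
  "G \<odot> H = \<lparr>
     verts = Inl ` verts G \<union> Inr ` (verts G \<times> verts H),
     edges = {Inl ` e | e. e \<in> edges G}
           \<union> {(\<lambda>x. Inr (v, x)) ` e | v e. v \<in> verts G \<and> e \<in> edges H}
           \<union> {{Inl v, Inr (v, x)} | v x. v \<in> verts G \<and> x \<in> verts H}\<rparr>"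

section \<open>Improper interval colorings\<close>

text \<open>At an isolated vertex the set of colors is empty, which is an interval (\<open>b < a\<close>).\<close>

definition improper_interval_coloring :: "'a ugraph \<Rightarrow> ('a set \<Rightarrow> nat) \<Rightarrow> bool" where
  "improper_interval_coloring G c \<longleftrightarrow>
     (\<forall>v\<in>verts G. \<exists>a b. c ` incident_edges G v = {a..b})"

definition k_improper :: "nat \<Rightarrow> 'a ugraph \<Rightarrow> ('a set \<Rightarrow> nat) \<Rightarrow> bool" where
  "k_improper k G c \<longleftrightarrow>
     (\<forall>v\<in>verts G. \<forall>i. card {e \<in> incident_edges G v. c e = i} \<le> k)"

definition mu_int :: "'a ugraph \<Rightarrow> nat" where
  "mu_int G = (LEAST k. 0 < k \<and> (\<exists>c. improper_interval_coloring G c \<and> k_improper k G c))"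

text \<open>The minimum in the definition of \<^const>\<open>mu_int\<close> is over a nonempty set.\<close>

lemma mu_int_attained:
  assumes "simple_graph G"
  shows "0 < mu_int G \<and> (\<exists>c. improper_interval_coloring G c \<and> k_improper (mu_int G) G c)"
proof -
  let ?k = "Suc (card (edges G))" and ?c = "\<lambda>_ :: 'a set. 0 :: nat"
  have fin: "finite (edges G)"
    using assms by (auto simp: simple_graph_def intro: finite_subset[of _ "Pow (verts G)"])
  have "\<exists>a b. ?c ` incident_edges G v = {a..b}" for v
  proof (cases "incident_edges G v = {}")
    case True
    then have "?c ` incident_edges G v = {1..0}" by simp
    then show ?thesis by blast
  next
    case False
    then have "?c ` incident_edges G v = {0..0}" by auto
    then show ?thesis by blast
  qed
  then have "improper_interval_coloring G ?c"
    by (simp add: improper_interval_coloring_def)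
  moreover have "k_improper ?k G ?c"
    unfolding k_improper_def incident_edges_def
    by (auto intro!: le_SucI card_mono fin)
  ultimately have "0 < ?k \<and> (\<exists>c. improper_interval_coloring G c \<and> k_improper ?k G c)" by blast
  then show ?thesis unfolding mu_int_def by (rule LeastI)
qed

end

theory Submission
  imports Defs
begin

text \<open>Joining a new vertex \<open>v\<close> to all vertices of a caterpillar \<open>C\<close> costs no more than impropriety
  two. List the vertices of \<open>C\<close> along the spine, each spine vertex followed by its leaves, and let
  \<open>f x\<close> be the position of \<open>x\<close> in this list. Color the spoke \<open>vx\<close> with \<open>f x\<close> and the edge \<open>xy\<close> of
  \<open>C\<close> with the larger of \<open>f x\<close> and \<open>f y\<close>. The later neighbors of a spine vertex are its leaves and
  then the next spine vertex, which come right after it in the list, so the edges to them carry on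
  the interval begun by the spoke, each color once. A vertex has at most one earlier
  neighbor, namely the previous spine vertex or, for a leaf, its support; the edge to it repeats the
  color of the spoke. So every color occurs at most twice at a vertex of \<open>C\<close>. At \<open>v\<close> itself the
  spokes carry the distinct colors \<open>0, \<dots>, |C| - 1\<close>.

  In the corona, start from an optimal coloring of \<open>G\<close> and shift the colors of the copy belonging
  to \<open>v\<close> so that they begin right above the largest color at \<open>v\<close>. The spokes then
  prolong the interval at \<open>v\<close> without repeating any of its colors. The argument splits
  accordingly into \<open>caterpillar_fan_order\<close>, which produces the list, and
  \<open>mu_int_corona_fan_order\<close>, which works for every graph with such a list.\<close>

section \<open>Adjacency in simple graphs\<close>

lemma adjacent_commute: "adjacent H x y \<longleftrightarrow> adjacent H y x"
  by (simp add: adjacent_def insert_commute)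

lemma adjacent_simpleD:
  assumes "simple_graph H" "adjacent H x y"
  shows "x \<in> verts H" "y \<in> verts H" "x \<noteq> y"
  using assms by (force simp: simple_graph_def adjacent_def)+

lemma incident_edges_eq_image:
  assumes "simple_graph H"
  shows "incident_edges H x = (\<lambda>y. {x, y}) ` {y. adjacent H x y}"
proof (intro equalityI subsetI)
  fix e assume e: "e \<in> incident_edges H x"
  then have "card e = 2" "x \<in> e" "e \<in> edges H"
    using assms by (auto simp: simple_graph_def incident_edges_def)
  then obtain y where "e = {x, y}" by (auto simp: card_2_iff)
  with \<open>e \<in> edges H\<close> show "e \<in> (\<lambda>y. {x, y}) ` {y. adjacent H x y}"
    by (auto simp: adjacent_def)
qed (auto simp: incident_edges_def adjacent_def)

lemma finite_neighbors:
  assumes "simple_graph H"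
  shows "finite {y. adjacent H x y}"
  by (rule finite_subset[of _ "verts H"])
     (use assms adjacent_simpleD(2)[OF assms] in \<open>auto simp: simple_graph_def\<close>)

lemma leaf_neighbor:
  assumes "simple_graph H" "x \<in> leaves H"
  obtains y where "\<And>z. adjacent H x z \<longleftrightarrow> z = y"
proof -
  have "inj_on (\<lambda>y. {x, y}) {y. adjacent H x y}"
    by (auto simp: inj_on_def doubleton_eq_iff)
  then have "card {y. adjacent H x y} = 1"
    using assms by (simp add: leaves_def degree_def incident_edges_eq_image card_image)
  then obtain y where "{y. adjacent H x y} = {y}" by (rule card_1_singletonE)
  then have "\<And>z. adjacent H x z \<longleftrightarrow> z = y" by blast
  then show thesis by (rule that)
qed

lemma connected_closed_set:
  assumes "connected_graph H" "x \<in> S" "x \<in> verts H"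
    and closed: "\<And>u v. u \<in> S \<Longrightarrow> adjacent H u v \<Longrightarrow> v \<in> S"
  shows "verts H \<subseteq> S"
proof
  fix y assume "y \<in> verts H"
  with assms obtain p where p: "is_walk H p" "hd p = x" "last p = y"
    unfolding connected_graph_def by blast
  have "successively (adjacent H) p \<Longrightarrow> p \<noteq> [] \<Longrightarrow> hd p \<in> S \<Longrightarrow> last p \<in> S"
    by (induction p rule: induct_list012) (auto dest: closed)
  with p \<open>x \<in> S\<close> show "y \<in> S" by (auto simp: is_walk_def)
qed

section \<open>Vertex orders that color a fan\<close>

text \<open>What the coloring needs of the list of vertices: the first part is for the interval at the
  new vertex, the bound on earlier neighbors for the impropriety at the vertices of \<open>H\<close>, and the
  run of later neighbors for the intervals there. The run may be empty (\<open>k = 0\<close>), as at a leaf.\<close>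

definition fan_order :: "'b ugraph \<Rightarrow> ('b \<Rightarrow> nat) \<Rightarrow> bool" where
  "fan_order H f \<longleftrightarrow> inj_on f (verts H) \<and> (\<exists>n. f ` verts H = {0..<n}) \<and>
     (\<forall>x\<in>verts H. card {y. adjacent H x y \<and> f y < f x} \<le> 1 \<and>
        (\<exists>k. f ` {y. adjacent H x y \<and> f x < f y} = {f x<..f x + k}))"

lemma fan_orderD:
  assumes "fan_order H f"
  shows "inj_on f (verts H)" "\<exists>n. f ` verts H = {0..<n}"
    and "x \<in> verts H \<Longrightarrow> card {y. adjacent H x y \<and> f y < f x} \<le> 1"
    and "x \<in> verts H \<Longrightarrow> \<exists>k. f ` {y. adjacent H x y \<and> f x < f y} = {f x<..f x + k}"
  using assms unfolding fan_order_def by blast+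

section \<open>The fan order of a caterpillar\<close>

text \<open>Two adjacent leaves form a whole component, so they occur only in the tree with two
  vertices. There, removing the leaves leaves nothing, and one of the two leaves serves as the
  spine. In every other caterpillar each leaf hangs on a spine vertex.\<close>

lemma caterpillar_spine:
  assumes "caterpillar C"
  obtains ps where "distinct ps" "set ps \<subseteq> verts C"
    and "\<And>i j. i < length ps \<Longrightarrow> j < length ps \<Longrightarrow>
           adjacent C (ps ! i) (ps ! j) \<longleftrightarrow> j = Suc i \<or> i = Suc j"
    and "\<And>x. x \<in> verts C - set ps \<Longrightarrow> \<exists>i<length ps. \<forall>y. adjacent C x y \<longleftrightarrow> y = ps ! i"
proof -
  have sg: "simple_graph C" and con: "connected_graph C"
    using assms by (auto simp: caterpillar_def is_tree_def)
  obtain vs where vs: "distinct vs" "verts C - leaves C = set vs"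
      "{e \<in> edges C. e \<subseteq> set vs} = {{vs ! i, vs ! Suc i} | i. Suc i < length vs}"
    using assms unfolding caterpillar_def path_graph_def induced_subgraph_def
    by (auto simp: Int_absorb1 Diff_subset)
  show thesis
  proof (cases "\<exists>x\<in>leaves C. \<exists>y\<in>leaves C. adjacent C x y")
    case True
    then obtain x y where xy: "x \<in> leaves C" "y \<in> leaves C" "adjacent C x y" by blast
    then have nx: "\<And>z. adjacent C x z \<longleftrightarrow> z = y" and ny: "\<And>z. adjacent C y z \<longleftrightarrow> z = x"
      by (metis leaf_neighbor[OF sg] adjacent_commute)+
    have "verts C \<subseteq> {x, y}"
      by (rule connected_closed_set[OF con, of x])
         (use nx ny adjacent_simpleD[OF sg xy(3)] in auto)
    then show thesis
      using that[of "[x]"] nx ny adjacent_simpleD[OF sg xy(3)] by auto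
  next
    case False
    show thesis
    proof (rule that[of vs])
      fix i j assume ij: "i < length vs" "j < length vs"
      have "adjacent C (vs ! i) (vs ! j)
          \<longleftrightarrow> {vs ! i, vs ! j} \<in> {e \<in> edges C. e \<subseteq> set vs}"
        using ij by (simp add: adjacent_def)
      also have "\<dots> \<longleftrightarrow> (\<exists>k. Suc k < length vs \<and> {vs ! i, vs ! j} = {vs ! k, vs ! Suc k})"
        unfolding vs(3) by blast
      also have "\<dots> \<longleftrightarrow> j = Suc i \<or> i = Suc j"
      proof
        assume "\<exists>k. Suc k < length vs \<and> {vs ! i, vs ! j} = {vs ! k, vs ! Suc k}"
        then obtain k where k: "Suc k < length vs" "{vs ! i, vs ! j} = {vs ! k, vs ! Suc k}"
          by blast
        then have "k < length vs" by simp
        then show "j = Suc i \<or> i = Suc j"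
          using k ij vs(1) by (auto simp: doubleton_eq_iff nth_eq_iff_index_eq)
      qed (use ij in \<open>auto simp: doubleton_eq_iff\<close>)
      finally show "adjacent C (vs ! i) (vs ! j) \<longleftrightarrow> j = Suc i \<or> i = Suc j" .
    next
      fix x assume "x \<in> verts C - set vs"
      then have x: "x \<in> leaves C" using vs(2) by blast
      then obtain y where y: "\<And>z. adjacent C x z \<longleftrightarrow> z = y" by (rule leaf_neighbor[OF sg]) blast
      then have "adjacent C x y" by simp
      then have "y \<in> set vs"
        using False x vs(2) adjacent_simpleD(2)[OF sg] by blast
      then obtain i where "i < length vs" "y = vs ! i" by (auto simp: in_set_conv_nth)
      with y show "\<exists>i<length vs. \<forall>y. adjacent C x y \<longleftrightarrow> y = vs ! i" by blast
    qed (use vs in auto)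
  qed
qed

text \<open>In the application the \<open>i\<close>-th block is a spine vertex \<open>p i\<close>
  together with its leaves.\<close>

lemma enumerate_blocks:
  fixes B :: "nat \<Rightarrow> 'b set" and p :: "nat \<Rightarrow> 'b"
  defines "s \<equiv> \<lambda>i. \<Sum>j<i. card (B j)"
  assumes "\<And>i. i < r \<Longrightarrow> finite (B i)" "\<And>i. i < r \<Longrightarrow> p i \<in> B i"
    and "\<And>i j. j < i \<Longrightarrow> i < r \<Longrightarrow> B i \<inter> B j = {}"
  shows "\<exists>f. bij_betw f (\<Union>i<r. B i) {0..<s r} \<and>
           (\<forall>i<r. f (p i) = s i \<and> f ` B i = {s i..<s (Suc i)})"
  using assms(2-)
proof (induction r)
  case 0
  then show ?case by (simp add: s_def bij_betw_def)
next
  case (Suc r)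
  then obtain g where g: "bij_betw g (\<Union>i<r. B i) {0..<s r}"
      "\<forall>i<r. g (p i) = s i \<and> g ` B i = {s i..<s (Suc i)}"
    by force
  have fin: "finite (B r)" and pr: "p r \<in> B r" using Suc.prems by auto
  have s_Suc: "s (Suc r) = s r + card (B r)" by (simp add: s_def)
  have pos: "0 < card (B r)" using fin pr by (auto simp: card_gt_0_iff)
  have "card (B r - {p r}) = card {Suc (s r)..<s (Suc r)}"
    using fin pr by (simp add: s_Suc)
  then obtain h where h: "bij_betw h (B r - {p r}) {Suc (s r)..<s (Suc r)}"
    using fin finite_same_card_bij by (metis finite_Diff finite_atLeastLessThan)
  let ?h = "h(p r := s r)"
  have "bij_betw ?h (B r - {p r}) {Suc (s r)..<s (Suc r)}"
    using h by (rule bij_betw_cong[THEN iffD1, rotated]) auto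
  then have "bij_betw ?h (insert (p r) (B r - {p r})) (insert (s r) {Suc (s r)..<s (Suc r)})"
    using notIn_Un_bij_betw[of "p r" "B r - {p r}" ?h] by auto
  moreover have "insert (s r) {Suc (s r)..<s (Suc r)} = {s r..<s (Suc r)}"
    using pos by (auto simp: s_Suc)
  ultimately have bij_h: "bij_betw ?h (B r) {s r..<s (Suc r)}"
    using pr by (simp add: insert_absorb)
  let ?f = "\<lambda>x. if x \<in> B r then ?h x else g x"
  have old: "x \<notin> B r" if "x \<in> B i" "i < r" for x i
    using Suc.prems(3)[of i r] that by blast
  have bij_new: "bij_betw ?f (B r) {s r..<s (Suc r)}"
    using bij_h by (rule bij_betw_cong[THEN iffD1, rotated]) auto
  have bij_old: "bij_betw ?f (\<Union>i<r. B i) {0..<s r}"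
    using g(1) by (rule bij_betw_cong[THEN iffD1, rotated]) (use old in auto)
  have "bij_betw ?f ((\<Union>i<r. B i) \<union> B r) ({0..<s r} \<union> {s r..<s (Suc r)})"
    by (rule bij_betw_combine[OF bij_old bij_new]) auto
  moreover have "(\<Union>i<r. B i) \<union> B r = (\<Union>i<Suc r. B i)"
    by (auto simp: less_Suc_eq)
  moreover have "{0..<s r} \<union> {s r..<s (Suc r)} = {0..<s (Suc r)}"
    by (auto simp: s_Suc)
  ultimately have bij: "bij_betw ?f (\<Union>i<Suc r. B i) {0..<s (Suc r)}" by simp
  have "?f (p i) = s i \<and> ?f ` B i = {s i..<s (Suc i)}" if "i < Suc r" for i
  proof (cases "i = r")
    case True
    then show ?thesis using pr bij_new by (simp add: bij_betw_def)
  next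
    case False
    then have "i < r" using that by simp
    moreover have "?f ` B i = g ` B i"
      by (rule image_cong) (use old[OF _ \<open>i < r\<close>] in auto)
    moreover have "p i \<notin> B r" using old[OF Suc.prems(2)[OF that] \<open>i < r\<close>] .
    ultimately show ?thesis using g(2) by simp
  qed
  with bij show ?case by blast
qed

lemma caterpillar_fan_order:
  assumes "caterpillar C"
  obtains f where "fan_order C f"
proof -
  have sg: "simple_graph C" using assms by (auto simp: caterpillar_def is_tree_def)
  then have finV: "finite (verts C)" by (simp add: simple_graph_def)
  obtain ps where ps: "distinct ps" "set ps \<subseteq> verts C"
    and spine: "\<And>i j. i < length ps \<Longrightarrow> j < length ps \<Longrightarrow>
           adjacent C (ps ! i) (ps ! j) \<longleftrightarrow> j = Suc i \<or> i = Suc j"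
    and leaf: "\<And>x. x \<in> verts C - set ps \<Longrightarrow> \<exists>i<length ps. \<forall>y. adjacent C x y \<longleftrightarrow> y = ps ! i"
    by (rule caterpillar_spine[OF assms], rule that, assumption+)
  define r where "r = length ps"
  define L where "L i = {x \<in> verts C - set ps. adjacent C x (ps ! i)}" for i
  define B where "B i = insert (ps ! i) (L i)" for i
  define s where "s i = (\<Sum>j<i. card (B j))" for i
  have L_unique: "i = j" if "x \<in> L i" "x \<in> L j" "i < r" "j < r" for x i j
    using that leaf[of x] ps(1) unfolding L_def r_def
    by (metis (no_types, lifting) mem_Collect_eq nth_eq_iff_index_eq)
  have finB: "finite (B i)" for i using finV by (simp add: B_def L_def)
  have disj: "B i \<inter> B j = {}" if "j < i" "i < r" for i j
    using that L_unique[of _ i j] ps(1)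
    by (auto simp: B_def r_def nth_eq_iff_index_eq) (auto simp: L_def)
  obtain f where bij: "bij_betw f (\<Union>i<r. B i) {0..<s r}"
    and f: "\<And>i. i < r \<Longrightarrow> f (ps ! i) = s i" "\<And>i. i < r \<Longrightarrow> f ` B i = {s i..<s (Suc i)}"
    using enumerate_blocks[of r B "\<lambda>i. ps ! i", OF finB _ disj] unfolding s_def[abs_def]
    by (metis B_def insertI1)
  have V: "verts C = (\<Union>i<r. B i)"
  proof (intro equalityI subsetI)
    fix x assume x: "x \<in> verts C"
    show "x \<in> (\<Union>i<r. B i)"
    proof (cases "x \<in> set ps")
      case True
      then show ?thesis by (auto simp: B_def r_def in_set_conv_nth)
    next
      case False
      then show ?thesis using leaf[of x] x by (auto simp: B_def L_def r_def)
    qed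
  qed (use ps(2) in \<open>auto simp: B_def L_def r_def\<close>)
  have inj: "inj_on f (verts C)" and img: "f ` verts C = {0..<s r}"
    using bij by (auto simp: V bij_betw_def)
  have fL: "f ` L i = {s i<..<s (Suc i)}" if "i < r" for i
  proof -
    have "L i = B i - {ps ! i}" using that by (auto simp: B_def L_def r_def)
    moreover have "f ` (B i - {ps ! i}) = f ` B i - f ` {ps ! i}"
      by (rule inj_on_image_set_diff[OF inj]) (use that V in \<open>auto simp: B_def\<close>)
    ultimately show ?thesis using f that by auto
  qed
  have s_less: "s i < s (Suc i)" for i
    using finB by (simp add: s_def B_def card_gt_0_iff)
  have s_mono: "s i < s j \<longleftrightarrow> i < j" for i j
    using s_less strict_mono_less[of s i j] by (simp add: strict_mono_Suc_iff)
  have nbr_spine: "adjacent C (ps ! i) y \<longleftrightarrow>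
      y \<in> L i \<or> (Suc i < r \<and> y = ps ! Suc i) \<or> (0 < i \<and> y = ps ! (i - 1))"
    if "i < r" for i y
  proof (cases "y \<in> set ps")
    case True
    then obtain j where j: "j < r" "y = ps ! j" by (auto simp: in_set_conv_nth r_def)
    then show ?thesis
      using that spine[of i j] True ps(1)
      by (auto simp: r_def L_def nth_eq_iff_index_eq)
  next
    case False
    then show ?thesis
      using that adjacent_simpleD(2)[OF sg] adjacent_commute[of C y]
      by (auto simp: L_def r_def)
  qed
  have "card {y. adjacent C x y \<and> f y < f x} \<le> 1 \<and>
        (\<exists>k. f ` {y. adjacent C x y \<and> f x < f y} = {f x<..f x + k})"
    if x: "x \<in> verts C" for x
  proof (cases "x \<in> set ps")
    case True
    then obtain i where i: "i < r" "x = ps ! i" by (auto simp: in_set_conv_nth r_def)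
    have fx: "f x = s i" using f i by simp
    have lf: "s i < f y" if "y \<in> L i" for y using fL[OF i(1)] that by auto
    have earlier: "{y. adjacent C x y \<and> f y < f x} \<subseteq> {ps ! (i - 1)}"
      using nbr_spine[OF i(1)] lf f s_mono fx i(2) by force
    have later: "{y. adjacent C x y \<and> f x < f y} =
        L i \<union> (if Suc i < r then {ps ! Suc i} else {})"
      using nbr_spine[OF i(1)] lf f s_mono fx i by auto
    \<comment> \<open>Position \<open>s (Suc i)\<close> belongs to the next spine vertex; if there is none, the run ends
      with the last leaf, one position before.\<close>
    let ?m = "if Suc i < r then s (Suc i) else s (Suc i) - 1"
    have "f ` {y. adjacent C x y \<and> f x < f y} = {f x<..?m}"
      using f(1) s_less[of i] unfolding later unfolding image_Un fL[OF i(1)] fx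
      by auto
    moreover have "?m = f x + (?m - f x)" using s_less[of i] fx by auto
    ultimately have "f ` {y. adjacent C x y \<and> f x < f y} = {f x<..f x + (?m - f x)}"
      by (rule trans[OF _ arg_cong])
    then have "\<exists>k. f ` {y. adjacent C x y \<and> f x < f y} = {f x<..f x + k}" by (rule exI)
    moreover have "card {y. adjacent C x y \<and> f y < f x} \<le> 1"
      using card_mono[OF _ earlier] by simp
    ultimately show ?thesis by blast
  next
    case False
    then obtain i where i: "i < r" "\<And>y. adjacent C x y \<longleftrightarrow> y = ps ! i"
      using leaf[of x] x by (auto simp: r_def)
    then have "x \<in> L i" using False x by (simp add: L_def)
    then have "f (ps ! i) < f x" using fL[OF i(1)] f i by auto
    then have nbr: "{y. adjacent C x y \<and> f y < f x} = {ps ! i}"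
        "{y. adjacent C x y \<and> f x < f y} = {}"
      using i(2) by auto
    then show ?thesis unfolding nbr by (intro conjI exI[of _ 0]) simp_all
  qed
  then have "fan_order C f" using inj img unfolding fan_order_def by blast
  then show thesis by (rule that)
qed

section \<open>Coloring a corona\<close>

lemma incident_edges_corona_Inl:
  assumes "v \<in> verts G"
  shows "incident_edges (G \<odot> H) (Inl v) =
     (`) Inl ` incident_edges G v \<union> (\<lambda>x. {Inl v, Inr (v, x)}) ` verts H"
  using assms by (auto simp: incident_edges_def corona_def)

lemma incident_edges_corona_Inr:
  assumes "simple_graph H" "v \<in> verts G" "x \<in> verts H"
  shows "incident_edges (G \<odot> H) (Inr (v, x)) =
     insert {Inl v, Inr (v, x)} ((\<lambda>y. {Inr (v, x), Inr (v, y)}) ` {y. adjacent H x y})"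
proof -
  have "incident_edges (G \<odot> H) (Inr (v, x)) =
      insert {Inl v, Inr (v, x)} ((`) (\<lambda>y. Inr (v, y)) ` incident_edges H x)"
    using assms(2,3) by (auto simp: incident_edges_def corona_def)
  then show ?thesis using assms(1) by (simp add: incident_edges_eq_image image_image)
qed

text \<open>Both the spokes and the edges inside a copy get the largest shifted position
  among their endpoints in the copy; \<open>t v\<close> is the shift for the copy at \<open>v\<close>.\<close>

definition corona_coloring ::
    "('a set \<Rightarrow> nat) \<Rightarrow> ('a \<Rightarrow> nat) \<Rightarrow> ('b \<Rightarrow> nat) \<Rightarrow> ('a + 'a \<times> 'b) set \<Rightarrow> nat" where
  "corona_coloring c t f e =
     (if Inr -` e = {} then c (Inl -` e) else Max ((\<lambda>(v, x). t v + f x) ` (Inr -` e)))"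

lemma corona_coloring_simps [simp]:
  fixes c :: "'a set \<Rightarrow> nat" and f :: "'b \<Rightarrow> nat"
  shows "corona_coloring c t f (Inl ` e) = c e"
  "corona_coloring c t f {Inl v, Inr (v, x)} = t v + f x"
  "corona_coloring c t f {Inr (v, x), Inr (v, y)} = t v + max (f x) (f y)"
proof -
  have "Inr -` (Inl ` e :: ('a + 'a \<times> 'b) set) = {}"
      "Inl -` (Inl ` e :: ('a + 'a \<times> 'b) set) = e"
    by auto
  then show "corona_coloring c t f (Inl ` e) = c e" by (simp add: corona_coloring_def)
  have "Inr -` {Inl v, Inr (v, x)} = {(v, x)}" by auto
  then show "corona_coloring c t f {Inl v, Inr (v, x)} = t v + f x"
    by (simp add: corona_coloring_def)
  have "Inr -` {Inr (v, x), Inr (v, y) :: 'a + 'a \<times> 'b} = {(v, x), (v, y)}" by auto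
  then show "corona_coloring c t f {Inr (v, x), Inr (v, y)} = t v + max (f x) (f y)"
    by (simp add: corona_coloring_def)
qed

lemma card_fiber_le_1:
  assumes "inj_on f A"
  shows "finite {x \<in> A. f x = i}" "card {x \<in> A. f x = i} \<le> 1"
proof -
  have "x = y" if "x \<in> {x \<in> A. f x = i}" "y \<in> {x \<in> A. f x = i}" for x y
    using assms that by (auto simp: inj_on_def)
  then obtain y where y: "{x \<in> A. f x = i} \<subseteq> {y}" by blast
  then show "finite {x \<in> A. f x = i}" by (rule finite_subset) simp
  show "card {x \<in> A. f x = i} \<le> 1" using card_mono[OF _ y] by simp
qed

text \<open>At a vertex \<open>v\<close> of \<open>G\<close> the shift \<open>t v\<close> bounds the old colors strictly and continues their
  interval, so old and new colors are disjoint and together fill an interval. The half-open form of the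
  old interval also covers a vertex that is isolated in \<open>G\<close>.\<close>

lemma corona_coloring_at_Inl:
  assumes H: "fan_order H f" and v: "v \<in> verts G" and k: "0 < k"
    and old: "c ` incident_edges G v = {a..<t v}"
    and mult: "\<And>i. card {e \<in> incident_edges G v. c e = i} \<le> k"
    and fin: "finite (edges G)" "finite (verts H)"
  shows "\<exists>a b. corona_coloring c t f ` incident_edges (G \<odot> H) (Inl v) = {a..b}"
    and "card {e \<in> incident_edges (G \<odot> H) (Inl v). corona_coloring c t f e = i} \<le> k"
proof -
  obtain n where n: "f ` verts H = {0..<n}" using fan_orderD(2)[OF H] by blast
  have "corona_coloring c t f ` incident_edges (G \<odot> H) (Inl v)
      = c ` incident_edges G v \<union> (\<lambda>j. t v + j) ` f ` verts H"
    by (simp add: incident_edges_corona_Inl[OF v] image_Un image_image)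
  also have "\<dots> = {a..<t v} \<union> {t v..<t v + n}" by (simp add: old n add.commute)
  also have "\<dots> = {min a (t v)..<t v + n}" by auto
  also have "\<exists>a' b'. \<dots> = {a'..b'}"
  proof (cases "t v + n")
    case 0
    then have "{min a (t v)..<t v + n} = {1..0}" by simp
    then show ?thesis by blast
  next
    case (Suc m)
    then show ?thesis by (auto simp: atLeastLessThanSuc_atLeastAtMost)
  qed
  finally show "\<exists>a b. corona_coloring c t f ` incident_edges (G \<odot> H) (Inl v) = {a..b}" .
next
  let ?X = "{e \<in> incident_edges (G \<odot> H) (Inl v). corona_coloring c t f e = i}"
  show "card ?X \<le> k"
  proof (cases "i < t v")
    case True
    then have "?X \<subseteq> (`) Inl ` {e \<in> incident_edges G v. c e = i}"
      by (auto simp: incident_edges_corona_Inl[OF v])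
    moreover have "finite {e \<in> incident_edges G v. c e = i}"
      using fin(1) by (simp add: incident_edges_def)
    ultimately have "card ?X \<le> card {e \<in> incident_edges G v. c e = i}"
      by (rule surj_card_le[rotated])
    then show ?thesis using mult le_trans by blast
  next
    case False
    have "c e < t v" if "e \<in> incident_edges G v" for e using old that by auto
    then have "?X \<subseteq> (\<lambda>x. {Inl v, Inr (v, x)}) ` {x \<in> verts H. f x = i - t v}"
      using False by (auto simp: incident_edges_corona_Inl[OF v])
    then have "card ?X \<le> card {x \<in> verts H. f x = i - t v}"
      using fin(2) by (intro surj_card_le) auto
    also have "\<dots> \<le> 1" by (rule card_fiber_le_1(2)[OF fan_orderD(1)[OF H]])
    finally show ?thesis using k by simp
  qed
qed

text \<open>At a vertex \<open>x\<close> of a copy, the spoke and the edge to the earlier neighbor share the color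
  of the position of \<open>x\<close>; the edges to later neighbors continue with distinct colors.\<close>

lemma corona_coloring_at_Inr:
  fixes G :: "'a ugraph" and H :: "'b ugraph"
  assumes sg: "simple_graph H" and H: "fan_order H f" and v: "v \<in> verts G" and x: "x \<in> verts H"
  shows "\<exists>a b. corona_coloring c t f ` incident_edges (G \<odot> H) (Inr (v, x)) = {a..b}"
    and "card {e \<in> incident_edges (G \<odot> H) (Inr (v, x)). corona_coloring c t f e = i} \<le> 2"
proof -
  let ?N = "{y. adjacent H x y}"
  obtain k where k: "f ` {y. adjacent H x y \<and> f x < f y} = {f x<..f x + k}"
    using fan_orderD(4)[OF H x] by blast
  have "insert (f x) ((\<lambda>y. max (f x) (f y)) ` ?N)
      = insert (f x) (f ` {y. adjacent H x y \<and> f x < f y})"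
    by (force simp: max_def image_iff)
  also have "\<dots> = {f x..f x + k}" unfolding k by auto
  finally have 1: "insert (f x) ((\<lambda>y. max (f x) (f y)) ` ?N) = {f x..f x + k}" .
  have "corona_coloring c t f ` incident_edges (G \<odot> H) (Inr (v, x))
      = (\<lambda>j. t v + j) ` insert (f x) ((\<lambda>y. max (f x) (f y)) ` ?N)"
    by (simp add: incident_edges_corona_Inr[OF sg v x] image_image)
  also have "\<dots> = {t v + f x..t v + (f x + k)}" unfolding 1 by simp
  finally show "\<exists>a b. corona_coloring c t f ` incident_edges (G \<odot> H) (Inr (v, x)) = {a..b}"
    by blast
next
  let ?X = "{e \<in> incident_edges (G \<odot> H) (Inr (v, x)). corona_coloring c t f e = i}"
  let ?g = "\<lambda>y. {Inr (v, x), Inr (v, y)} :: ('a + 'a \<times> 'b) set"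
  have nbr: "y \<in> verts H" "f y \<noteq> f x" if "adjacent H x y" for y
    using adjacent_simpleD[OF sg that] fan_orderD(1)[OF H] by (auto simp: inj_on_def)
  show "card ?X \<le> 2"
  proof (cases "i = t v + f x")
    case True
    let ?D = "{y. adjacent H x y \<and> f y < f x}"
    have fin: "finite ?D" using finite_neighbors[OF sg, of x] by simp
    have "?X \<subseteq> insert {Inl v, Inr (v, x)} (?g ` ?D)"
    proof
      fix e assume e: "e \<in> ?X"
      then consider "e = {Inl v, Inr (v, x)}" | y where "adjacent H x y" "e = ?g y"
        by (auto simp: incident_edges_corona_Inr[OF sg v x])
      then show "e \<in> insert {Inl v, Inr (v, x)} (?g ` ?D)"
      proof cases
        case 2
        then have "max (f x) (f y) = f x" using e True by simp
        then have "f y < f x" using nbr(2)[OF 2(1)] by (simp add: max_def split: if_splits)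
        then show ?thesis using 2 by blast
      qed simp
    qed
    then have "card ?X \<le> card (insert {Inl v, Inr (v, x)} (?g ` ?D))"
      using fin by (intro card_mono) auto
    also have "\<dots> \<le> Suc (card (?g ` ?D))" using fin by (simp add: card_insert_if)
    also have "\<dots> \<le> Suc (card ?D)" using card_image_le[OF fin] by simp
    also have "\<dots> \<le> 2" using fan_orderD(3)[OF H x] by simp
    finally show ?thesis .
  next
    case False
    then have "?X \<subseteq> ?g ` {y \<in> verts H. f y = i - t v}"
      using nbr(1) by (auto simp: incident_edges_corona_Inr[OF sg v x] max_def)
    then have "card ?X \<le> card {y \<in> verts H. f y = i - t v}"
      by (rule surj_card_le[rotated]) (rule card_fiber_le_1(1)[OF fan_orderD(1)[OF H]])
    also have "\<dots> \<le> 1" by (rule card_fiber_le_1(2)[OF fan_orderD(1)[OF H]])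
    finally show ?thesis by simp
  qed
qed

lemma mu_int_corona_fan_order:
  assumes G: "simple_graph G" and H: "simple_graph H" "fan_order H f"
  shows "mu_int (G \<odot> H) \<le> max 2 (mu_int G)"
proof -
  let ?k = "max 2 (mu_int G)"
  obtain c where c: "improper_interval_coloring G c" "k_improper (mu_int G) G c"
    using mu_int_attained[OF G] by blast
  have finE: "finite (edges G)"
    using G by (auto simp: simple_graph_def intro: finite_subset[of _ "Pow (verts G)"])
  have finH: "finite (verts H)" using H(1) by (simp add: simple_graph_def)
  have "\<exists>a t. c ` incident_edges G v = {a..<t}" if "v \<in> verts G" for v
    using c(1) that unfolding improper_interval_coloring_def
    by (metis atLeastLessThanSuc_atLeastAtMost)
  then obtain a t where old: "\<And>v. v \<in> verts G \<Longrightarrow> c ` incident_edges G v = {a v..<t v}"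
    by metis
  have mult: "card {e \<in> incident_edges G v. c e = i} \<le> ?k" if "v \<in> verts G" for v i
    using c(2) that unfolding k_improper_def by (meson le_trans max.cobounded2)
  let ?col = "corona_coloring c t f"
  have V: "\<And>w. w \<in> verts (G \<odot> H) \<Longrightarrow>
      (\<exists>v\<in>verts G. w = Inl v) \<or> (\<exists>v\<in>verts G. \<exists>x\<in>verts H. w = Inr (v, x))"
    by (auto simp: corona_def)
  have "improper_interval_coloring (G \<odot> H) ?col"
    unfolding improper_interval_coloring_def
  proof
    fix w assume "w \<in> verts (G \<odot> H)"
    then consider v where "v \<in> verts G" "w = Inl v"
      | v x where "v \<in> verts G" "x \<in> verts H" "w = Inr (v, x)"
      using V by blast
    then show "\<exists>a b. ?col ` incident_edges (G \<odot> H) w = {a..b}"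
    proof cases
      case 1
      then show ?thesis
        using corona_coloring_at_Inl(1)[where t = t, OF H(2) 1(1) _ old[OF 1(1)] mult[OF 1(1)] finE finH]
        by simp
    next
      case 2
      then show ?thesis using corona_coloring_at_Inr(1)[OF H 2(1,2)] by simp
    qed
  qed
  moreover have "k_improper ?k (G \<odot> H) ?col"
    unfolding k_improper_def
  proof (intro ballI allI)
    fix w i assume "w \<in> verts (G \<odot> H)"
    then consider v where "v \<in> verts G" "w = Inl v"
      | v x where "v \<in> verts G" "x \<in> verts H" "w = Inr (v, x)"
      using V by blast
    then show "card {e \<in> incident_edges (G \<odot> H) w. ?col e = i} \<le> ?k"
    proof cases
      case 1
      then show ?thesis
        using corona_coloring_at_Inl(2)[where t = t, OF H(2) 1(1) _ old[OF 1(1)] mult[OF 1(1)] finE finH]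
        by simp
    next
      case 2
      then show ?thesis
        using corona_coloring_at_Inr(2)[OF H 2(1,2), of c t i] by simp
    qed
  qed
  ultimately show ?thesis
    unfolding mu_int_def[of "G \<odot> H"] by (intro Least_le) auto
qed

theorem theorem23:
  fixes G :: "'a ugraph" and C :: "'b ugraph"
  assumes "simple_graph G" and "caterpillar C"
  shows "mu_int (G \<odot> C) \<le> max 2 (mu_int G)"
proof -
  obtain f where "fan_order C f" using assms(2) by (rule caterpillar_fan_order)
  moreover have "simple_graph C" using assms(2) by (simp add: caterpillar_def is_tree_def)
  ultimately show ?thesis using mu_int_corona_fan_order[OF assms(1)] by blast
qed

end
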